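(* Let $\gamma>0$, $A\in\mathbb{R}^{n\times n}$, $B\in\mathbb{R}^{n\times m}$, and let $Q\in\mathbb{R}^{n\times n}$ and $R\in\mathbb{R}^{m\times m}$ be symmetric positive definite. Let $\mathcal{M}=\{(A,B),(A,-B)\}$. Suppose there exist $K\in\mathbb{R}^{m\times n}$ and symmetric $P,T\in\mathbb{R}^{n\times n}$ satisfying $0\prec P\prec T\prec\gamma^2I$ and $$P\succeq Q+K^\top RK+(A-BK)^\top(P^{-1}-\gamma^{-2}I)^{-1}(A-BK),$$ $$T\succeq Q+K^\top RK+(A+BK)^\top(P^{-1}-\gamma^{-2}I)^{-1}(A+BK),$$ $$T\succeq Q+K^\top(R-\gamma^2B^\top B)K+A^\top(T^{-1}-\gamma^{-2}I)^{-1}A.$$ Then the Bellman inequality $\mathcal{F}\bar V\le\bar V$ (pointwise on $\mathbb{R}^n\times\mathbb{S}$) is satisfied by $$\bar V(x,Z):=\max\left\{|x|_P^2-\gamma^2\left\|\begin{bmatrix}I&A&\pm B\end{bmatrix}^\top\right\|_Z^2,\ \ |x|_T^2-\gamma^2\operatorname{trace}\left(\begin{bmatrix}[I\;\;A]^\top[I\;\;A]&0\\0&B^\top B\end{bmatrix}Z\right)\right\},$$ where the maximum is over the three expressions obtained from both signs $\pm$ in the first term and from the second term. Moreover, the bound $J_\mu(x_0)\le|x_0|_T^2$ holds for every $x_0\in\mathbb{R}^n$ for the control law $\mu$ defined by $$u_t=\begin{cases}-Kx_t&\text{if }\sum_{\tau=0}^{t-1}(x_{\tau+1}-Ax_\tau)^\top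 Bu_\tau\ge0,\\ Kx_t&\text{otherwise.}\end{cases}$$
   Context: Notation: for symmetric matrices, $\succ$, $\succeq$ denote the positive definite / semidefinite order. For a vector $x$ and symmetric $M$, $|x|_M^2:=x^\top Mx$, and $|x|$ is the Euclidean norm. For a matrix $C$ and symmetric $M$ of compatible size, $\|C\|_M^2:=\operatorname{trace}(C^\top MC)$. $\mathbb{S}$ denotes the set of symmetric positive semidefinite matrices in $\mathbb{R}^{(2n+m)\times(2n+m)}$. Cost of a control law: a control law $\mu=(\mu_t)_{t\ge0}$ is a sequence of functions giving $u_t=\mu_t(x_0,\ldots,x_t,u_0,\ldots,u_{t-1})\in\mathbb{R}^m$. For $x_0\in\mathbb{R}^n$, $$J_\mu(x_0):=\sup\ \sum_{t=0}^{h}\left(|x_t|_Q^2+|u_t|_R^2-\gamma^2|w_t|^2\right),$$ where the supremum is over all $(A',B')\in\mathcal{M}$, all integers $h\ge0$ and all sequences $w_t\in\mathbb{R}^n$, and $x,u$ are generated by $x_{t+1}=A'x_t+B'u_t+w_t$ for $t\ge0$ together with the control law $\mu$. Bellman operator: for a function $V$ on $\mathbb{R}^n\times\mathbb{S}$, $$\mathcal{F}V(x,Z):=\min_{u\in\mathbb{R}^m}\max_{v\in\mathbb{R}^n}\left\{|x|_Q^2+|u|_R^2+V\left(v,Z+\begin{bmatrix}-v\\ x\\ u\end{bmatrix}\begin{bmatrix}-v\\ x\\ u\end{bmatrix}^\top\right)\right\},$$ where max and min are understood as supremum and infimum (possibly $+\infty$) when not known to be attained. *)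

theory Defs
  imports "HOL-Analysis.Analysis"
begin

definition pos_def :: "real^'k^'k \<Rightarrow> bool" where
  "pos_def M \<longleftrightarrow> transpose M = M \<and> (\<forall>x. x \<noteq> 0 \<longrightarrow> 0 < x \<bullet> (M *v x))"

definition pos_semidef :: "real^'k^'k \<Rightarrow> bool" where
  "pos_semidef M \<longleftrightarrow> transpose M = M \<and> (\<forall>x. 0 \<le> x \<bullet> (M *v x))"

definition loewner_less :: "real^'k^'k \<Rightarrow> real^'k^'k \<Rightarrow> bool"  (infix "\<prec>" 50) where
  "M \<prec> N \<longleftrightarrow> pos_def (N - M)"

definition loewner_le :: "real^'k^'k \<Rightarrow> real^'k^'k \<Rightarrow> bool"  (infix "\<preceq>" 50) where
  "M \<preceq> N \<longleftrightarrow> pos_semidef (N - M)"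

definition vnorm2 :: "real^'k^'k \<Rightarrow> real^'k \<Rightarrow> real" where
  "vnorm2 M x = x \<bullet> (M *v x)"

definition mnorm2 :: "real^'k^'k \<Rightarrow> real^'l^'k \<Rightarrow> real" where
  "mnorm2 M C = trace (transpose C ** M ** C)"

text \<open>Block vectors and matrices are indexed by sum types; the index set of size
  \<open>2n + m\<close> is \<open>('n + 'n) + 'm\<close>.\<close>

definition vstack :: "real^'a \<Rightarrow> real^'b \<Rightarrow> real^('a + 'b)" where
  "vstack a b = (\<chi> i. case i of Inl k \<Rightarrow> a $ k | Inr k \<Rightarrow> b $ k)"

definition hcat :: "real^'a^'r \<Rightarrow> real^'b^'r \<Rightarrow> real^('a + 'b)^'r" where
  "hcat M N = (\<chi> i. vstack (M $ i) (N $ i))"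

definition block_diag :: "real^'a^'a \<Rightarrow> real^'b^'b \<Rightarrow> real^('a + 'b)^('a + 'b)" where
  "block_diag M N = (\<chi> i. case i of Inl k \<Rightarrow> vstack (M $ k) 0 | Inr k \<Rightarrow> vstack 0 (N $ k))"

definition outer :: "real^'k \<Rightarrow> real^'k^'k" where
  "outer z = (\<chi> i j. z $ i * z $ j)"

definition bellman ::
  "real^'n^'n \<Rightarrow> real^'m^'m \<Rightarrow>
   (real^'n \<Rightarrow> real^(('n + 'n) + 'm)^(('n + 'n) + 'm) \<Rightarrow> ereal) \<Rightarrow>
   real^'n \<Rightarrow> real^(('n + 'n) + 'm)^(('n + 'n) + 'm) \<Rightarrow> ereal" where
  "bellman Q R V x Z =
     (INF u. SUP v. ereal (vnorm2 Q x + vnorm2 R u) + V v (Z + outer (vstack (vstack (- v) x) u)))"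

text \<open>The law at time \<open>t\<close> is applied to the lists \<open>[x\<^sub>0, \<dots>, x\<^sub>t]\<close> and
  \<open>[u\<^sub>0, \<dots>, u\<^bsub>t-1\<^esub>]\<close>.\<close>

type_synonym ('n, 'm) control_law = "nat \<Rightarrow> (real^'n) list \<Rightarrow> (real^'m) list \<Rightarrow> real^'m"

text \<open>For given \<open>\<mu>\<close>, \<open>A\<close>, \<open>B\<close>, \<open>w\<close> and \<open>x 0\<close> exactly one pair \<open>x\<close>, \<open>u\<close> satisfies this relation,
  since \<open>u t\<close> depends only on \<open>x\<close> up to \<open>t\<close> and on \<open>u\<close> strictly before \<open>t\<close>.\<close>

definition closed_loop ::
  "('n, 'm) control_law \<Rightarrow> real^'n^'n \<Rightarrow> real^'m^'n \<Rightarrow> (nat \<Rightarrow> real^'n) \<Rightarrow>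
   (nat \<Rightarrow> real^'n) \<Rightarrow> (nat \<Rightarrow> real^'m) \<Rightarrow> bool" where
  "closed_loop \<mu> A B w x u \<longleftrightarrow>
     (\<forall>t. u t = \<mu> t (map x [0..<Suc t]) (map u [0..<t])) \<and>
     (\<forall>t. x (Suc t) = A *v x t + B *v u t + w t)"

definition cost ::
  "real^'n^'n \<Rightarrow> real^'m^'m \<Rightarrow> real \<Rightarrow> ((real^'n^'n) \<times> (real^'m^'n)) set \<Rightarrow>
   ('n, 'm) control_law \<Rightarrow> real^'n \<Rightarrow> ereal" where
  "cost Q R \<gamma> \<M> \<mu> x0 =
     Sup {ereal (\<Sum>t=0..h. vnorm2 Q (x t) + vnorm2 R (u t) - \<gamma>\<^sup>2 * (norm (w t))\<^sup>2) | A' B' h w x u.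
            (A', B') \<in> \<M> \<and> x 0 = x0 \<and> closed_loop \<mu> A' B' w x u}"

definition Vbar ::
  "real \<Rightarrow> real^'n^'n \<Rightarrow> real^'m^'n \<Rightarrow> real^'n^'n \<Rightarrow> real^'n^'n \<Rightarrow>
   real^'n \<Rightarrow> real^(('n + 'n) + 'm)^(('n + 'n) + 'm) \<Rightarrow> real" where
  "Vbar \<gamma> A B P T x Z =
     Max {vnorm2 P x - \<gamma>\<^sup>2 * mnorm2 Z (transpose (hcat (hcat (mat 1) A) B)),
          vnorm2 P x - \<gamma>\<^sup>2 * mnorm2 Z (transpose (hcat (hcat (mat 1) A) (- B))),
          vnorm2 T x - \<gamma>\<^sup>2 * trace (block_diag (transpose (hcat (mat 1) A) ** hcat (mat 1) A)
                                              (transpose B ** B) ** Z)}"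

definition switching_law ::
  "real^'n^'n \<Rightarrow> real^'m^'n \<Rightarrow> real^'n^'m \<Rightarrow> ('n, 'm) control_law" where
  "switching_law A B K t xs us =
     (if 0 \<le> (\<Sum>\<tau><t. (xs ! Suc \<tau> - A *v (xs ! \<tau>)) \<bullet> (B *v (us ! \<tau>)))
      then - (K *v (xs ! t)) else K *v (xs ! t))"

end

(* The two block forms of Z are the accumulated squared misfits p and m of the models (A, B) and
   (A, -B), and by the parallelogram law the third one is their mean. Hence Vbar is a function of
   (x, p, m) only. Use u = -K x if p \<le> m and u = K x otherwise. For a fixed successor v, each of
   the three new terms is then bounded by an old term by one of the three Riccati inequalities,
   because |v|_P^2 - \<gamma>^2 |y - v|^2 is at most |y|^2 weighted by (P^-1 - \<gamma>^-2 I)^-1, and likewise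
   for T. Summation of this one-step inequality along a trajectory bounds the cost; the true model
   has misfit \<Sum> |w_t|^2, and the sign of the sum in the switching law is the sign of m - p. *)
theory Submission
  imports Defs
begin

section \<open>Quadratic forms\<close>

lemma inner_transpose_matrix: "x \<bullet> (transpose A *v y) = (A *v x) \<bullet> y"
  for A :: "real^'n^'m"
  by (metis dot_lmul_matrix transpose_matrix_vector inner_commute)

lemma vnorm2_congruence: "vnorm2 (transpose A ** M ** A) x = vnorm2 M (A *v x)"
  by (simp add: vnorm2_def inner_transpose_matrix del: transpose_matrix_vector
      flip: matrix_vector_mul_assoc)

lemma vnorm2_transpose_self: "vnorm2 (transpose A ** A) x = (norm (A *v x))\<^sup>2"
  using vnorm2_congruence[of A "mat 1" x] by (simp add: vnorm2_def power2_norm_eq_inner)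

lemma vnorm2_add: "vnorm2 (M + N) x = vnorm2 M x + vnorm2 N x"
  by (simp add: vnorm2_def matrix_vector_mult_add_rdistrib inner_right_distrib)

lemma vnorm2_diff: "vnorm2 (M - N) x = vnorm2 M x - vnorm2 N x"
  by (simp add: vnorm2_def matrix_vector_mult_diff_rdistrib inner_diff_right)

lemma vnorm2_scaleR: "vnorm2 (c *\<^sub>R M) x = c * vnorm2 M x"
  by (simp add: vnorm2_def flip: scaleR_matrix_vector_assoc)

lemma matrix_vector_mult_minus: "M *v (- x) = - (M *v x)" "(- M) *v x = - (M *v x)"
  for M :: "real^'n^'m"
  using matrix_vector_mult_diff_distrib[of M 0 x] matrix_vector_mult_diff_rdistrib[of 0 M x]
  by simp_all

lemma vnorm2_minus_arg: "vnorm2 M (- x) = vnorm2 M x"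
  by (simp add: vnorm2_def matrix_vector_mult_minus)

lemma loewner_leD:
  assumes "M \<preceq> N"
  shows "vnorm2 M x \<le> vnorm2 N x"
proof -
  have "0 \<le> vnorm2 (N - M) x"
    using assms by (simp add: loewner_le_def pos_semidef_def vnorm2_def)
  then show ?thesis by (simp add: vnorm2_diff)
qed

lemma loewner_lessD:
  fixes M :: "real^'n^'n"
  assumes "M \<prec> N" "x \<noteq> 0"
  shows "vnorm2 M x < vnorm2 N x"
proof -
  have "0 < vnorm2 (N - M) x"
    using assms by (simp add: loewner_less_def pos_def_def vnorm2_def)
  then show ?thesis by (simp add: vnorm2_diff)
qed

lemma vnorm2_zero [simp]: "vnorm2 0 x = 0" "vnorm2 M 0 = 0"
  by (simp_all add: vnorm2_def)

lemma loewner_less_imp_le: "M \<prec> N \<Longrightarrow> vnorm2 M x \<le> vnorm2 N x"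
  for M :: "real^'n^'n"
  using loewner_lessD[of M N x] by (cases "x = 0") auto

lemma loewner_less_trans:
  fixes M N L :: "real^'n^'n"
  assumes "M \<prec> N" "N \<prec> L"
  shows "M \<prec> L"
proof -
  have "transpose (L - M) = L - M"
  proof -
    have "transpose (L - M) = transpose (L - N) + transpose (N - M)"
      by (simp add: transpose_def vec_eq_iff)
    then show ?thesis using assms by (simp add: loewner_less_def pos_def_def)
  qed
  moreover have "0 < vnorm2 (L - M) x" if "x \<noteq> 0" for x
    using loewner_lessD[OF assms(1) that] loewner_lessD[OF assms(2) that]
    by (simp add: vnorm2_diff)
  ultimately show ?thesis by (simp add: loewner_less_def pos_def_def vnorm2_def)
qed

section \<open>Inverses and the maximization over the successor state\<close>

lemma matrix_inv_cancel:
  fixes A :: "real^'n^'n"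
  assumes "\<forall>x. A *v x = 0 \<longrightarrow> x = 0"
  shows "A *v (matrix_inv A *v x) = x" and "matrix_inv A *v (A *v x) = x"
proof -
  have "invertible A"
    using assms by (simp add: invertible_left_inverse matrix_left_invertible_ker)
  then have "A ** matrix_inv A = mat 1 \<and> matrix_inv A ** A = mat 1"
    unfolding invertible_def matrix_inv_def by (rule someI_ex)
  then show "A *v (matrix_inv A *v x) = x" and "matrix_inv A *v (A *v x) = x"
    by (simp_all add: matrix_vector_mul_assoc)
qed

text \<open>As \<open>P \<prec> \<gamma>\<^sup>2 *\<^sub>R mat 1\<close>, the left side is strictly
  concave in \<open>v\<close>. Completing the square around its stationary point, the solution
  \<open>p\<close> of \<open>y = p - (1 / \<gamma>\<^sup>2) *\<^sub>R (P *v p)\<close>, leaves the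
  right side as its maximal value.\<close>

lemma disturbance_maximum_le:
  fixes P :: "real^'n^'n"
  assumes g: "\<gamma> > 0" and sym: "transpose P = P"
    and P: "0 \<prec> P" "P \<prec> \<gamma>\<^sup>2 *\<^sub>R mat 1"
  shows "vnorm2 P v - \<gamma>\<^sup>2 * (norm (y - v))\<^sup>2
    \<le> vnorm2 (matrix_inv (matrix_inv P - (1 / \<gamma>\<^sup>2) *\<^sub>R mat 1)) y"
proof -
  define S where "S = matrix_inv P - (1 / \<gamma>\<^sup>2) *\<^sub>R mat 1"
  define g2 where "g2 = \<gamma>\<^sup>2"
  have g2: "g2 > 0" using g by (simp add: g2_def)
  have Ppos: "0 < vnorm2 P x" if "x \<noteq> 0" for x
    using loewner_lessD[OF P(1) that] by simp
  have Pup: "vnorm2 P x < g2 * (x \<bullet> x)" if "x \<noteq> 0" for x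
    using loewner_lessD[OF P(2) that] unfolding vnorm2_scaleR by (simp add: vnorm2_def g2_def)
  have "\<forall>x. P *v x = 0 \<longrightarrow> x = 0"
    using Ppos by (force simp: vnorm2_def)
  note Pinv = matrix_inv_cancel[OF this]
  have Sx: "S *v x = matrix_inv P *v x - (1 / g2) *\<^sub>R x" for x
    by (simp add: S_def g2_def matrix_vector_mult_diff_rdistrib flip: scaleR_matrix_vector_assoc)
  \<comment> \<open>A nonzero kernel vector of \<open>S\<close> would be an eigenvector of
    \<open>P\<close> with eigenvalue \<gamma>^2, which the strict upper bound on \<open>P\<close>
    excludes.\<close>
  have "x = 0" if "S *v x = 0" for x
  proof (rule ccontr)
    assume "x \<noteq> 0"
    have "matrix_inv P *v x = (1 / g2) *\<^sub>R x" using that Sx[of x] by simp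
    then have "x = (1 / g2) *\<^sub>R (P *v x)"
      using Pinv(1)[of x] by (simp add: matrix_vector_mult_scaleR)
    then have "g2 *\<^sub>R x = g2 *\<^sub>R ((1 / g2) *\<^sub>R (P *v x))" by simp
    then have "P *v x = g2 *\<^sub>R x" using g2 by simp
    then show False using Pup[OF \<open>x \<noteq> 0\<close>] by (simp add: vnorm2_def)
  qed
  then have "\<forall>x. S *v x = 0 \<longrightarrow> x = 0" by blast
  note Sinv = matrix_inv_cancel[OF this]
  define p where "p = matrix_inv P *v (matrix_inv S *v y)"
  have z: "matrix_inv S *v y = P *v p" by (simp add: p_def Pinv)
  have y: "y = p - (1 / g2) *\<^sub>R (P *v p)"
    using Sinv(1)[of y] Sx[of "matrix_inv S *v y"] by (simp add: p_def Pinv)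
  \<comment> \<open>\<open>p\<close> is the maximizing \<open>v\<close>.\<close>
  have "vnorm2 P (v - p) \<le> g2 * ((v - p) \<bullet> (v - p))"
    using Pup[of "v - p"] by (cases "v = p") auto
  moreover have "v \<bullet> (P *v p) = p \<bullet> (P *v v)"
    using inner_transpose_matrix[of p P v] by (simp add: sym inner_commute)
  ultimately have "vnorm2 P v + vnorm2 P p - 2 * (v \<bullet> (P *v p))
      \<le> g2 * (v \<bullet> v + p \<bullet> p - 2 * (v \<bullet> p))"
    by (simp add: vnorm2_def matrix_vector_mult_diff_distrib inner_diff_left inner_diff_right
        inner_commute[of p v])
  moreover have "vnorm2 (matrix_inv S) y = vnorm2 P p - (1 / g2) * ((P *v p) \<bullet> (P *v p))"
    unfolding vnorm2_def z by (subst y) (simp add: inner_diff_left)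
  moreover have "g2 * (norm (y - v))\<^sup>2 = g2 * (v \<bullet> v + p \<bullet> p - 2 * (v \<bullet> p))
      - 2 * vnorm2 P p + 2 * (v \<bullet> (P *v p)) + (1 / g2) * ((P *v p) \<bullet> (P *v p))"
  proof -
    define q where "q = P *v p"
    have "(norm (y - v))\<^sup>2 = v \<bullet> v + p \<bullet> p - 2 * (v \<bullet> p)
        - 2 * ((1 / g2) * (p \<bullet> q)) + 2 * ((1 / g2) * (v \<bullet> q)) + (1 / g2) * ((1 / g2) * (q \<bullet> q))"
      unfolding power2_norm_eq_inner y q_def[symmetric]
      by (simp add: inner_diff_left inner_diff_right inner_commute[of q p] inner_commute[of q v]
          inner_commute[of p v] diff_divide_distrib)
    then show ?thesis using g2 by (simp add: vnorm2_def q_def field_simps)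
  qed
  ultimately show ?thesis unfolding S_def g2_def by linarith
qed

section \<open>Block matrices\<close>

lemma sum_UNIV_Plus: "(\<Sum>i\<in>UNIV. f i) = (\<Sum>a\<in>UNIV. f (Inl a)) + (\<Sum>b\<in>UNIV. f (Inr b))"
  for f :: "'a::finite + 'b::finite \<Rightarrow> real"
  by (simp add: sum.Plus flip: UNIV_Plus_UNIV)

lemma vstack_nth [simp]: "vstack a b $ Inl i = a $ i" "vstack a b $ Inr j = b $ j"
  by (simp_all add: vstack_def)

lemma hcat_mult_vstack: "hcat M N *v vstack a b = M *v a + N *v b"
  by (simp add: vec_eq_iff matrix_vector_mult_def hcat_def sum_UNIV_Plus)

text \<open>The parallelogram law for Gram matrices: the cross blocks of \<open>G\<close> with
  \<open>B\<close> and with \<open>- B\<close> cancel.\<close>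

lemma hcat_gram_sum:
  "transpose (hcat G B) ** hcat G B + transpose (hcat G (- B)) ** hcat G (- B)
    = 2 *\<^sub>R block_diag (transpose G ** G) (transpose B ** B)"
proof -
  have "(transpose (hcat G B) ** hcat G B + transpose (hcat G (- B)) ** hcat G (- B)) $ i $ j
    = (2 *\<^sub>R block_diag (transpose G ** G) (transpose B ** B)) $ i $ j" for i j
    by (cases i; cases j)
      (simp_all add: matrix_matrix_mult_def transpose_def hcat_def block_diag_def sum_negf)
  then show ?thesis by (simp add: vec_eq_iff)
qed

lemma mnorm2_transpose: "mnorm2 Z (transpose F) = trace (transpose F ** F ** Z)"
  unfolding mnorm2_def transpose_transpose
  by (metis trace_mul_sym matrix_mul_assoc)

lemma trace_mult_outer: "trace (M ** outer z) = vnorm2 M z"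
  by (simp add: trace_def vnorm2_def outer_def matrix_matrix_mult_def matrix_vector_mult_def
      inner_vec_def sum_distrib_left mult_ac)

text \<open>With \<open>F\<close> the row [I A B'] and \<open>z\<close> the stacked vector of -v, x
  and u, the increment is the squared one-step residual |A x + B' u - v|^2. This is how
  \<open>Z\<close> accumulates misfits.\<close>

lemma mnorm2_add_outer:
  "mnorm2 (Z + outer z) (transpose F) = mnorm2 Z (transpose F) + (norm (F *v z))\<^sup>2"
  by (simp add: mnorm2_transpose matrix_add_ldistrib trace_add trace_mult_outer
      vnorm2_transpose_self)

lemma trace_block_diag_gram:
  "trace (block_diag (transpose G ** G) (transpose B ** B) ** Z)
    = (mnorm2 Z (transpose (hcat G B)) + mnorm2 Z (transpose (hcat G (- B)))) / 2"
proof -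
  let ?D = "block_diag (transpose G ** G) (transpose B ** B)"
  have "mnorm2 Z (transpose (hcat G B)) + mnorm2 Z (transpose (hcat G (- B)))
      = trace ((2 *\<^sub>R ?D) ** Z)"
    unfolding hcat_gram_sum[symmetric] mnorm2_transpose
    by (simp add: trace_def matrix_matrix_mult_def sum.distrib distrib_right)
  also have "\<dots> = 2 * trace (?D ** Z)"
    by (simp add: trace_def matrix_matrix_mult_def sum_distrib_left mult.assoc)
  finally show ?thesis by simp
qed

section \<open>The one-step inequality\<close>

text \<open>The first term contains \<open>min p m\<close> because the larger of the two
  \<open>P\<close>-expressions belongs to the model with the smaller misfit.\<close>

definition misfit_value ::
  "real \<Rightarrow> real^'n^'n \<Rightarrow> real^'n^'n \<Rightarrow> real^'n \<Rightarrow> real \<Rightarrow> real \<Rightarrow> real" where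
  "misfit_value \<gamma> P T x p m =
     max (vnorm2 P x - \<gamma>\<^sup>2 * min p m) (vnorm2 T x - \<gamma>\<^sup>2 * ((p + m) / 2))"

lemma Vbar_eq_misfit_value:
  "Vbar \<gamma> A B P T x Z = misfit_value \<gamma> P T x
     (mnorm2 Z (transpose (hcat (hcat (mat 1) A) B)))
     (mnorm2 Z (transpose (hcat (hcat (mat 1) A) (- B))))"
proof -
  have "max (a - \<gamma>\<^sup>2 * p) (a - \<gamma>\<^sup>2 * m) = a - \<gamma>\<^sup>2 * min p m" for a p m :: real
    by (smt (verit) mult_left_mono zero_le_power2)
  then show ?thesis
    by (simp add: Vbar_def misfit_value_def trace_block_diag_gram flip: max.assoc)
qed

text \<open>The Riccati inequalities with the matrix inverses eliminated by letting \<open>v\<close>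
  range freely. The feedback is -K x under (A, B) in \<open>riccati_consistent\<close> and K x in
  \<open>riccati_inconsistent\<close>; \<open>riccati_mean\<close> averages over both.\<close>

locale riccati_inequalities =
  fixes \<gamma> :: real
    and A :: "real^'n^'n" and B :: "real^'m^'n"
    and Q :: "real^'n^'n" and R :: "real^'m^'m"
    and K :: "real^'n^'m" and P T :: "real^'n^'n"
  assumes riccati_consistent: "\<And>x v. vnorm2 Q x + vnorm2 R (K *v x) + vnorm2 P v
      - \<gamma>\<^sup>2 * (norm (A *v x - B *v (K *v x) - v))\<^sup>2 \<le> vnorm2 P x"
    and riccati_inconsistent: "\<And>x v. vnorm2 Q x + vnorm2 R (K *v x) + vnorm2 P v
      - \<gamma>\<^sup>2 * (norm (A *v x + B *v (K *v x) - v))\<^sup>2 \<le> vnorm2 T x"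
    and riccati_mean: "\<And>x v. vnorm2 Q x + vnorm2 R (K *v x) + vnorm2 T v
      - \<gamma>\<^sup>2 * ((norm (A *v x - v))\<^sup>2 + (norm (B *v (K *v x)))\<^sup>2) \<le> vnorm2 T x"
    and P_nonneg: "\<And>x. 0 \<le> vnorm2 P x"
    and P_le_T: "\<And>x. vnorm2 P x \<le> vnorm2 T x"
begin

lemma riccati_parallelogram:
  "vnorm2 Q x + vnorm2 R (K *v x) + vnorm2 T v
      - \<gamma>\<^sup>2 * (((norm (A *v x + B *v (K *v x) - v))\<^sup>2 + (norm (A *v x - B *v (K *v x) - v))\<^sup>2) / 2)
    \<le> vnorm2 T x"
proof -
  have "((norm (a + b - v))\<^sup>2 + (norm (a - b - v))\<^sup>2) / 2 = (norm (a - v))\<^sup>2 + (norm b)\<^sup>2"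
    for a b v :: "real^'n"
    by (simp add: power2_norm_eq_inner inner_diff_left inner_diff_right inner_add_left
        inner_add_right inner_commute)
  then show ?thesis using riccati_mean[of x v] by (simp only:)
qed

text \<open>For p \<le> m, \<open>riccati_consistent\<close> bounds the term with p by the old
  \<open>P\<close>-term and \<open>riccati_parallelogram\<close> handles the mean.
  \<open>riccati_inconsistent\<close> bounds the term with m by |x|_T^2 - \<gamma>^2 m, which the
  old \<open>T\<close>-term dominates because m is at least the mean.\<close>

lemma misfit_value_step:
  assumes u: "u = (if p \<le> m then - (K *v x) else K *v x)"
  shows "vnorm2 Q x + vnorm2 R u
      + misfit_value \<gamma> P T v (p + (norm (A *v x + B *v u - v))\<^sup>2) (m + (norm (A *v x - B *v u - v))\<^sup>2)
    \<le> misfit_value \<gamma> P T x p m"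
proof -
  let ?e = "(norm (A *v x - B *v (K *v x) - v))\<^sup>2"
  let ?f = "(norm (A *v x + B *v (K *v x) - v))\<^sup>2"
  have R: "vnorm2 R u = vnorm2 R (K *v x)" using u by (simp add: vnorm2_minus_arg)
  have step: "vnorm2 Q x + vnorm2 R (K *v x) + misfit_value \<gamma> P T v (p' + ?e) (m' + ?f)
      \<le> misfit_value \<gamma> P T x p' m'" if le: "p' \<le> m'" for p' m'
  proof -
    have *: "\<gamma>\<^sup>2 * p' \<le> \<gamma>\<^sup>2 * ((p' + m') / 2)" "\<gamma>\<^sup>2 * ((p' + m') / 2) \<le> \<gamma>\<^sup>2 * m'"
      using le by (intro mult_left_mono; simp)+
    then show ?thesis
      using riccati_consistent[of x v] riccati_inconsistent[of x v] riccati_parallelogram[of x v] le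
      unfolding misfit_value_def
      by (auto simp: max_def min_def algebra_simps add_divide_distrib)
  qed
  \<comment> \<open>Flipping the sign of \<open>u\<close> exchanges the two residuals, so by this
    symmetry the case p > m is the first case with p and m swapped.\<close>
  have comm: "misfit_value \<gamma> P T y a b = misfit_value \<gamma> P T y b a" for y a b
    by (simp add: misfit_value_def min.commute add.commute)
  show ?thesis
  proof (cases "p \<le> m")
    case True
    then show ?thesis using step[of p m] R u by (simp add: matrix_vector_mult_minus)
  next
    case False
    then show ?thesis using step[of m p] R u by (simp add: comm[of _ m] comm[of _ "m + _"])
  qed
qed

lemma bellman_le:
  "bellman Q R (\<lambda>x' Z'. ereal (Vbar \<gamma> A B P T x' Z')) x Z \<le> ereal (Vbar \<gamma> A B P T x Z)"
proof -
  let ?C = "\<lambda>B. hcat (hcat (mat 1) A) B"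
  let ?p = "mnorm2 Z (transpose (?C B))" and ?m = "mnorm2 Z (transpose (?C (- B)))"
  define u where "u = (if ?p \<le> ?m then - (K *v x) else K *v x)"
  have C: "?C B' *v vstack (vstack (- v) x) u = A *v x + B' *v u - v" for B' v
    by (simp add: hcat_mult_vstack)
  have "vnorm2 Q x + vnorm2 R u + Vbar \<gamma> A B P T v (Z + outer (vstack (vstack (- v) x) u))
      \<le> Vbar \<gamma> A B P T x Z" for v
    using misfit_value_step[OF u_def, of v]
    by (simp add: Vbar_eq_misfit_value mnorm2_add_outer C matrix_vector_mult_minus)
  \<comment> \<open>The chosen \<open>u\<close> does not depend on \<open>v\<close>, so it bounds
    the infimum over inputs of the supremum over successors.\<close>
  then show ?thesis
    unfolding bellman_def by (intro INF_lower2[of u] SUP_least) auto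
qed

section \<open>The cost along a closed-loop trajectory\<close>

lemma trajectory_cost_le:
  assumes model: "B' = B \<or> B' = - B"
    and loop: "closed_loop (switching_law A B K) A B' w x u"
  shows "(\<Sum>t<h. vnorm2 Q (x t) + vnorm2 R (u t) - \<gamma>\<^sup>2 * (norm (w t))\<^sup>2) \<le> vnorm2 T (x 0)"
proof -
  define p where "p h = (\<Sum>t<h. (norm (A *v x t + B *v u t - x (Suc t)))\<^sup>2)" for h
  define m where "m h = (\<Sum>t<h. (norm (A *v x t - B *v u t - x (Suc t)))\<^sup>2)" for h
  \<comment> \<open>Polarization: with r = x(t+1) - A x(t), each summand is |r + B u|^2 - |r - B
    u|^2 = 4 r \<bullet> (B u).\<close>
  have "m h - p h = 4 * (\<Sum>t<h. (x (Suc t) - A *v x t) \<bullet> (B *v u t))" for h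
    unfolding m_def p_def sum_subtractf[symmetric] sum_distrib_left
    by (intro sum.cong) (simp_all add: power2_norm_eq_inner inner_diff_left inner_diff_right
        inner_add_left inner_add_right inner_commute)
  then have sign: "0 \<le> (\<Sum>t<h. (x (Suc t) - A *v x t) \<bullet> (B *v u t)) \<longleftrightarrow> p h \<le> m h" for h
    by (smt (verit))
  have u: "u t = (if p t \<le> m t then - (K *v x t) else K *v x t)" for t
  proof -
    \<comment> \<open>The state list has t + 1 entries, so the index \<open>Suc \<tau>\<close> with
      \<tau> < t stays in range.\<close>
    have hist: "map x [0..<Suc t] ! i = x i" if "i \<le> t" for i
      using that by (simp del: upt_Suc)
    have "(\<Sum>\<tau><t. (map x [0..<Suc t] ! Suc \<tau> - A *v (map x [0..<Suc t] ! \<tau>)) \<bullet> (B *v (map u [0..<t] ! \<tau>)))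
      = (\<Sum>\<tau><t. (x (Suc \<tau>) - A *v x \<tau>) \<bullet> (B *v u \<tau>))"
      by (intro sum.cong) (simp_all add: hist del: upt_Suc)
    then have "switching_law A B K t (map x [0..<Suc t]) (map u [0..<t])
      = (if p t \<le> m t then - (K *v x t) else K *v x t)"
      unfolding switching_law_def by (simp add: hist sign del: upt_Suc)
    then show ?thesis using loop unfolding closed_loop_def by metis
  qed
  \<comment> \<open>The one-step inequality telescopes from zero misfits, the situation before any
    data.\<close>
  have tele: "(\<Sum>t<h. vnorm2 Q (x t) + vnorm2 R (u t)) + misfit_value \<gamma> P T (x h) (p h) (m h)
      \<le> misfit_value \<gamma> P T (x 0) 0 0" for h
  proof (induction h)
    case 0
    then show ?case by (simp add: p_def m_def)
  next
    case (Suc h)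
    have "p (Suc h) = p h + (norm (A *v x h + B *v u h - x (Suc h)))\<^sup>2"
      and "m (Suc h) = m h + (norm (A *v x h - B *v u h - x (Suc h)))\<^sup>2"
      by (simp_all add: p_def m_def)
    then show ?case using Suc misfit_value_step[OF u, of h "x (Suc h)"] by simp
  qed
  have w: "w t = x (Suc t) - A *v x t - B' *v u t" for t
    using loop by (simp add: closed_loop_def)
  have "(\<Sum>t<h. (norm (w t))\<^sup>2) = p h \<or> (\<Sum>t<h. (norm (w t))\<^sup>2) = m h"
  proof -
    have "norm (w t) = norm (A *v x t + B' *v u t - x (Suc t))" for t
      unfolding w by (metis diff_diff_eq norm_minus_commute)
    then show ?thesis using model by (auto simp: p_def m_def matrix_vector_mult_minus)
  qed
  \<comment> \<open>The disturbance energy is the misfit of the true model, hence at least the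
    smaller misfit; with |x_h|_P^2 \<ge> 0 this bounds the final value from below.\<close>
  then have "\<gamma>\<^sup>2 * min (p h) (m h) \<le> \<gamma>\<^sup>2 * (\<Sum>t<h. (norm (w t))\<^sup>2)"
    by (intro mult_left_mono) auto
  then have "- (\<gamma>\<^sup>2 * (\<Sum>t<h. (norm (w t))\<^sup>2)) \<le> misfit_value \<gamma> P T (x h) (p h) (m h)"
    using P_nonneg[of "x h"] unfolding misfit_value_def by linarith
  moreover have "misfit_value \<gamma> P T (x 0) 0 0 = vnorm2 T (x 0)"
    using P_le_T[of "x 0"] by (simp add: misfit_value_def)
  ultimately show ?thesis
    using tele[of h] by (simp add: sum_subtractf sum_distrib_left)
qed

end

section \<open>From the matrix inequalities to the Bellman inequality and the cost bound\<close>

theorem theorem2: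
  fixes \<gamma> :: real
    and A :: "real^'n^'n" and B :: "real^'m^'n"
    and Q :: "real^'n^'n" and R :: "real^'m^'m"
    and K :: "real^'n^'m" and P T :: "real^'n^'n"
  assumes "\<gamma> > 0"
    and "pos_def Q" and "pos_def R"
    and "transpose P = P" and "transpose T = T"
    and "0 \<prec> P" and "P \<prec> T" and "T \<prec> \<gamma>\<^sup>2 *\<^sub>R mat 1"
    and "Q + transpose K ** R ** K
          + transpose (A - B ** K) ** matrix_inv (matrix_inv P - (1 / \<gamma>\<^sup>2) *\<^sub>R mat 1) ** (A - B ** K)
         \<preceq> P"
    and "Q + transpose K ** R ** K
          + transpose (A + B ** K) ** matrix_inv (matrix_inv P - (1 / \<gamma>\<^sup>2) *\<^sub>R mat 1) ** (A + B ** K)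
         \<preceq> T"
    and "Q + transpose K ** (R - \<gamma>\<^sup>2 *\<^sub>R (transpose B ** B)) ** K
          + transpose A ** matrix_inv (matrix_inv T - (1 / \<gamma>\<^sup>2) *\<^sub>R mat 1) ** A
         \<preceq> T"
  shows "(\<forall>x. \<forall>Z. pos_semidef Z \<longrightarrow>
            bellman Q R (\<lambda>x' Z'. ereal (Vbar \<gamma> A B P T x' Z')) x Z \<le> ereal (Vbar \<gamma> A B P T x Z))
       \<and> (\<forall>x0. cost Q R \<gamma> {(A, B), (A, - B)} (switching_law A B K) x0 \<le> ereal (vnorm2 T x0))"

proof -
  have "0 \<prec> T" "P \<prec> \<gamma>\<^sup>2 *\<^sub>R mat 1"
    using assms(6-8) loewner_less_trans by blast+
  note maxP = disturbance_maximum_le[OF assms(1,4,6) this(2)]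
    and maxT = disturbance_maximum_le[OF assms(1,5) this(1) assms(8)]
  note expand = vnorm2_add vnorm2_congruence vnorm2_diff vnorm2_scaleR vnorm2_transpose_self
    matrix_vector_mult_diff_rdistrib matrix_vector_mult_add_rdistrib matrix_vector_mul_assoc[symmetric]
  interpret riccati_inequalities \<gamma> A B Q R K P T
  proof
    fix x v
    show "vnorm2 Q x + vnorm2 R (K *v x) + vnorm2 P v
      - \<gamma>\<^sup>2 * (norm (A *v x - B *v (K *v x) - v))\<^sup>2 \<le> vnorm2 P x"
      using loewner_leD[OF assms(9), of x] maxP[of v "A *v x - B *v (K *v x)"]
      by (simp add: expand)
    show "vnorm2 Q x + vnorm2 R (K *v x) + vnorm2 P v
      - \<gamma>\<^sup>2 * (norm (A *v x + B *v (K *v x) - v))\<^sup>2 \<le> vnorm2 T x"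
      using loewner_leD[OF assms(10), of x] maxP[of v "A *v x + B *v (K *v x)"]
      by (simp add: expand)
    \<comment> \<open>The block \<open>R - \<gamma>\<^sup>2 *\<^sub>R (transpose B ** B)\<close>,
      evaluated at K x, supplies the term -\<gamma>^2 |B K x|^2.\<close>
    show "vnorm2 Q x + vnorm2 R (K *v x) + vnorm2 T v
      - \<gamma>\<^sup>2 * ((norm (A *v x - v))\<^sup>2 + (norm (B *v (K *v x)))\<^sup>2) \<le> vnorm2 T x"
      using loewner_leD[OF assms(11), of x] maxT[of v "A *v x"]
      by (simp add: expand algebra_simps)
    show "0 \<le> vnorm2 P x" and "vnorm2 P x \<le> vnorm2 T x"
      using loewner_less_imp_le[OF assms(6), of x] loewner_less_imp_le[OF assms(7), of x] by simp_all
  qed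
  have "cost Q R \<gamma> {(A, B), (A, - B)} (switching_law A B K) x0 \<le> ereal (vnorm2 T x0)" for x0
    unfolding cost_def
  proof (rule Sup_least, clarify)
    fix A' B' h w x u
    assume "(A', B') \<in> {(A, B), (A, - B)}" "closed_loop (switching_law A B K) A' B' w x u"
    then have "B' = B \<or> B' = - B" "closed_loop (switching_law A B K) A B' w x u" by auto
    \<comment> \<open>The cost sums up to and including h, hence \<open>Suc h\<close> for the strict
      bound.\<close>
    from trajectory_cost_le[OF this, of "Suc h"]
    show "ereal (\<Sum>t=0..h. vnorm2 Q (x t) + vnorm2 R (u t) - \<gamma>\<^sup>2 * (norm (w t))\<^sup>2)
        \<le> ereal (vnorm2 T (x 0))"
      by (simp only: ereal_less_eq lessThan_Suc_atMost atLeast0AtMost)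
  qed
  then show ?thesis using bellman_le by blast
qed

end
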